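(* Let $n$ and $r$ be positive integers with $n\ge 2r$. Then $m(K(n,r))\ge m(K(n+1,r))$. Moreover, regarding every vertex of $K(n,r)$ (an $r$-subset of $[n]$) also as a vertex of $K(n+1,r)$ (since $[n]\subseteq[n+1]$), if $S$ is a monophonic set of $K(n,r)$, then $S$ is a monophonic set of $K(n+1,r)$.
   Context: For positive integers $n\ge 2r$, the Kneser graph $K(n,r)$ has as vertices all $r$-element subsets of $[n]=\{1,\dots,n\}$, two vertices being adjacent iff they are disjoint. For a graph $G$ and $u,v\in V(G)$, the monophonic interval $J_G(u,v)$ is the set of all vertices lying on some induced $u,v$-path in $G$ (in particular $u,v\in J_G(u,v)$, and $J_G(u,u)=\{u\}$). A set $S\subseteq V(G)$ is a monophonic set of $G$ if for every $w\in V(G)$ there exist $x,y\in S$ with $w\in J_G(x,y)$. The monophonic number $m(G)$ is the minimum cardinality of a monophonic set of $G$.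
   Formalization: The case r = 1 is excluded, because there K(n,1) is the complete graph on n vertices, whose only monophonic set is the whole vertex set, so m(K(n,1)) = n < n+1 = m(K(n+1,1)) and both assertions fail for every n ≥ 2. *)

theory Defs
  imports "Graph_Theory.Graph_Theory"
begin

text \<open>Simple graphs are represented, as in the theory Digraph of the entry Graph_Theory, by
  finite loop-free symmetric digraphs.\<close>

definition kneser_graph :: "nat \<Rightarrow> nat \<Rightarrow> nat set pair_pre_digraph" where
  "kneser_graph n r =
     \<lparr> pverts = {A. A \<subseteq> {1..n} \<and> card A = r},
       parcs = {(A, B). A \<subseteq> {1..n} \<and> card A = r \<and> B \<subseteq> {1..n} \<and> card B = r \<and> A \<inter> B = {}} \<rparr>"

text \<open>Positivity of \<open>r\<close> is what excludes a loop: for \<open>r = 0\<close> the empty set is disjoint from itself.\<close>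

lemma pair_graph_kneser_graph:
  assumes "0 < r"
  shows "pair_graph (kneser_graph n r)"
proof
  show "fst e \<in> pverts (kneser_graph n r)" "snd e \<in> pverts (kneser_graph n r)"
    if "e \<in> parcs (kneser_graph n r)" for e
    using that by (auto simp: kneser_graph_def)
  have sub: "pverts (kneser_graph n r) \<subseteq> Pow {1..n}"
    unfolding kneser_graph_def by auto
  show fin: "finite (pverts (kneser_graph n r))"
    by (rule finite_subset[OF sub]) simp
  have "parcs (kneser_graph n r) \<subseteq> pverts (kneser_graph n r) \<times> pverts (kneser_graph n r)"
    by (auto simp: kneser_graph_def)
  then show "finite (parcs (kneser_graph n r))"
    using fin by (meson finite_SigmaI finite_subset)
  have arc: "card A = r \<and> A \<inter> B = {} \<and> (B, A) \<in> parcs (kneser_graph n r)"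
    if "(A, B) \<in> parcs (kneser_graph n r)" for A B
    using that unfolding kneser_graph_def pair_pre_digraph.simps mem_Collect_eq prod.case by blast
  show "fst e \<noteq> snd e" if e: "e \<in> parcs (kneser_graph n r)" for e
  proof
    assume "fst e = snd e"
    with e have "(fst e, fst e) \<in> parcs (kneser_graph n r)" by (metis prod.collapse)
    then have "card (fst e) = r" and "fst e = {}" using arc by blast+
    with assms show False by (metis card.empty less_irrefl)
  qed
  show "symmetric (with_proj (kneser_graph n r))"
    unfolding symmetric_def with_proj_simps by (rule symI) (use arc in blast)
qed

text \<open>The subgraph induced by the vertices of the path has no edges other than those of the
  path; the one-vertex path is allowed.\<close>

definition induced_vpath :: "'a vwalk \<Rightarrow> ('a, 'b) pre_digraph \<Rightarrow> bool" where
  "induced_vpath p G \<longleftrightarrow> vpath p G \<and>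
     (\<forall>i < length p. \<forall>j < length p. (p ! i, p ! j) \<in> arcs_ends G \<longrightarrow> j = Suc i \<or> i = Suc j)"

definition monophonic_interval :: "('a, 'b) pre_digraph \<Rightarrow> 'a \<Rightarrow> 'a \<Rightarrow> 'a set" where
  "monophonic_interval G u v =
     {w. \<exists>p. induced_vpath p G \<and> hd p = u \<and> last p = v \<and> w \<in> set p}"

definition monophonic_set :: "('a, 'b) pre_digraph \<Rightarrow> 'a set \<Rightarrow> bool" where
  "monophonic_set G S \<longleftrightarrow> S \<subseteq> verts G \<and>
     (\<forall>w \<in> verts G. \<exists>x \<in> S. \<exists>y \<in> S. w \<in> monophonic_interval G x y)"

text \<open>Intended for finite graphs, where the vertex set itself is a monophonic set, so that the
  minimum is attained.\<close>

definition monophonic_number :: "('a, 'b) pre_digraph \<Rightarrow> nat" where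
  "monophonic_number G = (LEAST k. \<exists>S. monophonic_set G S \<and> finite S \<and> card S = k)"

text \<open>A pitfall at \<open>r = 1\<close>: there \<open>kneser_graph n 1\<close> is the complete graph on \<open>n\<close> vertices, every
  induced path has at most two vertices, and so the only monophonic set is the whole vertex set
  and the monophonic number is \<open>n\<close>. Hence neither the monophonic number is non-increasing in \<open>n\<close>
  nor do monophonic sets stay monophonic when \<open>n\<close> grows; results of that kind need \<open>r \<noteq> 1\<close>.\<close>

end

(* Let w be a vertex of K(n+1,r) containing n+1, and write A for w without n+1. For b in [n] - A
   put v b = insert b A, a vertex of K(n,r), which lies on an induced path p of K(n,r) between two
   members of S. Neighbours of v b in K(n,r) are neighbours of w. If v b is interior to p for some
   b, then w has two neighbours at distance 2 on p, and joining the first and the last neighbour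
   of w on p through w gives an induced path with the same ends. Otherwise all the v b belong to
   S, and v b, insert c X, w, insert b X, v c is an induced path, where X is a set of r - 1
   elements of [n] avoiding A, b and c; this uses that A and X are nonempty, i.e. r >= 2. *)
theory Submission
  imports Defs
begin

section \<open>Induced paths in general graphs\<close>

lemma set_vwalk_arcs_subset_iff:
  "set (vwalk_arcs p) \<subseteq> E \<longleftrightarrow> (\<forall>i. Suc i < length p \<longrightarrow> (p ! i, p ! Suc i) \<in> E)"
proof (induction p rule: vwalk_arcs.induct)
  case (3 x y xs)
  show ?case
    using 3 by (auto simp: all_conj_distrib nth_Cons split: nat.splits)
qed auto

text \<open>The arc relation of a \<open>graph\<close> is symmetric and irreflexive, so the walk
  condition and the absence of chords merge into one equivalence over index pairs
  \<open>i < j\<close>. Every path constructed below is checked in this form.\<close>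

lemma (in graph) induced_vpath_iff:
  "induced_vpath p G \<longleftrightarrow> p \<noteq> [] \<and> set p \<subseteq> verts G \<and> distinct p \<and>
     (\<forall>i j. i < j \<and> j < length p \<longrightarrow> ((p ! i, p ! j) \<in> arcs_ends G \<longleftrightarrow> j = Suc i))"
    (is "?L \<longleftrightarrow> ?R")
proof
  assume L: ?L
  then have walk: "\<And>i. Suc i < length p \<Longrightarrow> (p ! i, p ! Suc i) \<in> arcs_ends G"
    and ind: "\<And>i j. i < length p \<Longrightarrow> j < length p \<Longrightarrow> (p ! i, p ! j) \<in> arcs_ends G
      \<Longrightarrow> j = Suc i \<or> i = Suc j"
    by (auto simp: induced_vpath_def vpath_def vwalk_def set_vwalk_arcs_subset_iff)
  have "(p ! i, p ! j) \<in> arcs_ends G \<longleftrightarrow> j = Suc i" if "i < j" "j < length p" for i j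
    using walk[of i] ind[of i j] that by auto
  then show ?R
    using L by (auto simp: induced_vpath_def vpath_def vwalk_def)
next
  assume R: ?R
  have "j = Suc i \<or> i = Suc j"
    if "i < length p" "j < length p" "(p ! i, p ! j) \<in> arcs_ends G" for i j
  proof (cases i j rule: linorder_cases)
    case equal
    then show ?thesis using that adj_not_same by auto
  next
    case greater
    then show ?thesis using R that arcs_ends_symmetric[OF sym_arcs] by blast
  qed (use R that in blast)
  then show ?L
    using R by (auto simp: induced_vpath_def vpath_def vwalk_def set_vwalk_arcs_subset_iff)
qed

text \<open>With \<open>a\<close> and \<open>b\<close> the extreme indices of neighbours of
  \<open>w\<close> on \<open>p\<close>, \<open>w\<close> has no further neighbour on the pieces of
  \<open>p\<close> before and after the detour. Since \<open>a \<le> i\<close>,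
  \<open>Suc i < j\<close> and \<open>j \<le> b\<close>, at least one vertex of \<open>p\<close> is
  cut out, so no arc joins the two pieces.\<close>

lemma (in graph) mem_monophonic_interval_splice:
  assumes p: "induced_vpath p G"
    and w: "w \<in> verts G" "w \<notin> set p"
    and ij: "Suc i < j" "j < length p"
    and adj: "(p ! i, w) \<in> arcs_ends G" "(w, p ! j) \<in> arcs_ends G"
  shows "w \<in> monophonic_interval G (hd p) (last p)"
proof -
  define N where "N = {k. k < length p \<and> (p ! k, w) \<in> arcs_ends G}"
  have sym: "(x, y) \<in> arcs_ends G \<Longrightarrow> (y, x) \<in> arcs_ends G" for x y
    using arcs_ends_symmetric[OF sym_arcs] .
  have "finite N" "i \<in> N" "j \<in> N"
    using ij adj sym by (auto simp: N_def)
  define a where "a = Min N"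
  define b where "b = Max N"
  have N: "a \<in> N" "b \<in> N" "a \<le> i" "j \<le> b" "\<And>k. k \<in> N \<Longrightarrow> a \<le> k \<and> k \<le> b"
    using \<open>finite N\<close> \<open>i \<in> N\<close> \<open>j \<in> N\<close> unfolding a_def b_def by (auto intro: Min_in Max_in)
  then have ab: "Suc a < b" "b < length p"
    using ij by (auto simp: N_def)
  from p have pD: "p \<noteq> []" "set p \<subseteq> verts G" "distinct p"
    and pE: "\<And>k l. k < l \<Longrightarrow> l < length p \<Longrightarrow> (p ! k, p ! l) \<in> arcs_ends G \<longleftrightarrow> l = Suc k"
    unfolding induced_vpath_iff by auto
  define q where "q = take (Suc a) p @ w # drop b p"
  have len: "length q = Suc (Suc a) + (length p - b)"
    using ab by (simp add: q_def)
  \<comment> \<open>Behind \<open>w\<close>, which sits at index \<open>Suc a\<close>, index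
    \<open>Suc (Suc a)\<close> of \<open>q\<close> corresponds to index \<open>b\<close> of
    \<open>p\<close>.\<close>
  have q_nth: "q ! k = (if k \<le> a then p ! k else if k = Suc a then w else p ! (k - Suc (Suc a) + b))"
    if "k < length q" for k
    using that ab len by (auto simp: q_def nth_append nth_Cons min_def add.commute split: nat.split
      intro!: arg_cong[of _ _ "(!) p"])
  have disj: "set (take (Suc a) p) \<inter> set (drop b p) = {}"
    using pD(3) ab by (intro set_take_disj_set_drop_if_distinct) auto
  have "induced_vpath q G"
    unfolding induced_vpath_iff
  proof (intro conjI allI impI)
    show "q \<noteq> []" by (simp add: q_def)
    show "set q \<subseteq> verts G"
      using pD(2) w(1) by (auto simp: q_def dest: in_set_takeD in_set_dropD)
    show "distinct q"
      using pD(3) w(2) disj by (auto simp: q_def dest: in_set_takeD in_set_dropD)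
    fix k l assume "k < l \<and> l < length q"
    then have kl: "k < l" "l < length q" "k < length q" by auto
    \<comment> \<open>The cases are: both vertices before \<open>w\<close>, the second one is
      \<open>w\<close>, one on each side of \<open>w\<close>, the first one is \<open>w\<close>,
      both after \<open>w\<close>.\<close>
    consider "l \<le> a" | "k \<le> a" "l = Suc a" | "k \<le> a" "Suc a < l" | "k = Suc a" | "Suc a < k"
      by linarith
    then show "(q ! k, q ! l) \<in> arcs_ends G \<longleftrightarrow> l = Suc k"
    proof cases
      case 1
      then show ?thesis using kl ab pE by (simp add: q_nth)
    next
      case 2
      have "(p ! k, w) \<in> arcs_ends G \<longleftrightarrow> k = a"
        using N(1) N(5)[of k] 2 ab by (auto simp: N_def)
      then show ?thesis using 2 kl by (auto simp: q_nth)
    next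
      case 3
      \<comment> \<open>Both sides are false: the second vertex has index at least \<open>b\<close>
        in \<open>p\<close>, which exceeds \<open>Suc a\<close> and hence
        \<open>Suc k\<close>.\<close>
      then show ?thesis using kl ab len pE[of k "l - Suc (Suc a) + b"] by (auto simp: q_nth)
    next
      case 4
      define m where "m = l - Suc (Suc a) + b"
      have m: "b \<le> m" "m < length p" "l = Suc k \<longleftrightarrow> m = b"
        using 4 kl len ab by (auto simp: m_def)
      have "(w, p ! m) \<in> arcs_ends G \<longleftrightarrow> m = b"
        using N(2) N(5)[of m] m sym by (auto simp: N_def)
      then show ?thesis using 4 kl m by (simp add: q_nth m_def)
    next
      case 5
      then show ?thesis
        using kl len ab pE[of "k - Suc (Suc a) + b" "l - Suc (Suc a) + b"] by (auto simp: q_nth)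
    qed
  qed
  moreover have "hd q = hd p" "last q = last p" "w \<in> set q"
    using pD(1) ab by (auto simp: q_def hd_append)
  ultimately show ?thesis
    unfolding monophonic_interval_def by blast
qed

text \<open>Being an induced path depends only on the arcs among the vertices of the path, and the
  last assumption makes \<open>H\<close> an induced subgraph of \<open>G\<close>.\<close>

lemma induced_vpath_superdigraph:
  assumes "induced_vpath p H" "verts H \<subseteq> verts G"
    and "arcs_ends H = arcs_ends G \<inter> verts H \<times> verts H"
  shows "induced_vpath p G"
proof -
  have "set p \<subseteq> verts H"
    using assms(1) by (auto simp: induced_vpath_def)
  then have "p ! i \<in> verts H" if "i < length p" for i
    using that by (meson nth_mem subsetD)
  then show ?thesis
    using assms by (auto simp: induced_vpath_def vpath_def vwalk_def)
qed

text \<open>One-vertex paths suffice. For finite graphs this guarantees that the minimum in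
  \<open>monophonic_number\<close> is attained.\<close>

lemma (in graph) monophonic_set_verts: "monophonic_set G (verts G)"
proof -
  have "w \<in> monophonic_interval G w w" if "w \<in> verts G" for w
    using that unfolding monophonic_interval_def induced_vpath_iff
    by (auto intro!: exI[of _ "[w]"])
  then show ?thesis
    unfolding monophonic_set_def by blast
qed

section \<open>Kneser graphs with different ground sets\<close>

lemma graph_kneser_graph: "0 < r \<Longrightarrow> graph (with_proj (kneser_graph n r))"
  by (intro pair_graph.pair_graphD_graph pair_graph_kneser_graph)

lemma pverts_kneser_graph: "pverts (kneser_graph n r) = {A. A \<subseteq> {1..n} \<and> card A = r}"
  by (simp add: kneser_graph_def)

lemma verts_kneser_graph_mono:
  assumes "m \<le> n"
  shows "verts (with_proj (kneser_graph m r)) \<subseteq> verts (with_proj (kneser_graph n r))"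
proof -
  have "{1..m} \<subseteq> {1..n}" using assms by simp
  then show ?thesis unfolding with_proj_simps pverts_kneser_graph by blast
qed

lemma arcs_ends_kneser_graph:
  "(A, B) \<in> arcs_ends (with_proj (kneser_graph n r)) \<longleftrightarrow>
     A \<in> verts (with_proj (kneser_graph n r)) \<and> B \<in> verts (with_proj (kneser_graph n r)) \<and> A \<inter> B = {}"
  by (auto simp: kneser_graph_def)

text \<open>Disjointness of two sets does not depend on the ground set, so the smaller Kneser graph
  is an induced subgraph of the larger one.\<close>

lemma induced_vpath_kneser_graph_mono:
  assumes "induced_vpath p (with_proj (kneser_graph m r))" "m \<le> n"
  shows "induced_vpath p (with_proj (kneser_graph n r))"
  using assms(1)
proof (rule induced_vpath_superdigraph)
  show *: "verts (with_proj (kneser_graph m r)) \<subseteq> verts (with_proj (kneser_graph n r))"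
    using assms(2) by (rule verts_kneser_graph_mono)
  show "arcs_ends (with_proj (kneser_graph m r)) = arcs_ends (with_proj (kneser_graph n r)) \<inter>
      verts (with_proj (kneser_graph m r)) \<times> verts (with_proj (kneser_graph m r))"
    using * by (auto simp only: arcs_ends_kneser_graph)
qed

section \<open>Monophonic sets when the ground set grows by one element\<close>

lemma monophonic_set_kneser_graph_Suc:
  assumes r: "2 \<le> r" and n: "2 * r \<le> n"
    and S: "monophonic_set (with_proj (kneser_graph n r)) S"
  shows "monophonic_set (with_proj (kneser_graph (Suc n) r)) S"
proof -
  let ?H = "with_proj (kneser_graph n r)" and ?G = "with_proj (kneser_graph (Suc n) r)"
  interpret G: graph ?G by (rule graph_kneser_graph) (use r in simp)
  have HG: "verts ?H \<subseteq> verts ?G"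
    by (rule verts_kneser_graph_mono) simp
  \<comment> \<open>The same path is recorded in both graphs: in \<open>?H\<close> its vertices
    avoid \<open>Suc n\<close>, and in \<open>?G\<close> it can be rerouted through a new
    vertex.\<close>
  have covered: "\<exists>x\<in>S. \<exists>y\<in>S. \<exists>p. induced_vpath p ?H \<and> induced_vpath p ?G \<and>
      hd p = x \<and> last p = y \<and> v \<in> set p" if "v \<in> verts ?H" for v
    using S that induced_vpath_kneser_graph_mono[of _ n r "Suc n"]
    unfolding monophonic_set_def monophonic_interval_def by fastforce
  have "\<exists>x\<in>S. \<exists>y\<in>S. w \<in> monophonic_interval ?G x y" if w: "w \<in> verts ?G" for w
  proof (cases "Suc n \<in> w")
    case False
    then have "w \<in> verts ?H"
      using w by (auto simp: pverts_kneser_graph atLeastAtMostSuc_conv)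
    then show ?thesis
      using covered unfolding monophonic_interval_def by blast
  next
    case True
    define A where "A = w - {Suc n}"
    have w_eq: "w = insert (Suc n) A" and "Suc n \<notin> A"
      using True by (auto simp: A_def)
    have "A \<subseteq> {1..n}"
      using w by (auto simp: A_def pverts_kneser_graph atLeastAtMostSuc_conv)
    then have "finite A" by (rule finite_subset) simp
    have cA: "card A = r - 1"
      using w \<open>finite A\<close> \<open>Suc n \<notin> A\<close> by (auto simp: w_eq pverts_kneser_graph)
    have vH: "insert b A \<in> verts ?H" if "b \<in> {1..n} - A" for b
      using that r cA \<open>A \<subseteq> {1..n}\<close> \<open>finite A\<close> by (auto simp: pverts_kneser_graph)
    show ?thesis
    proof (cases "\<forall>b \<in> {1..n} - A. insert b A \<in> S")
      case False
      then obtain b where b: "b \<in> {1..n} - A" "insert b A \<notin> S" by blast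
      from covered[OF vH[OF b(1)]] obtain p where
        p: "induced_vpath p ?H" "induced_vpath p ?G" "hd p \<in> S" "last p \<in> S" "insert b A \<in> set p"
        by blast
      then obtain m where m: "m < length p" "p ! m = insert b A"
        by (meson in_set_conv_nth)
      have "p \<noteq> []" using m by auto
      \<comment> \<open>The ends of \<open>p\<close> lie in \<open>S\<close> and
        \<open>insert b A\<close> does not, so \<open>m\<close> is an interior index with a
        neighbour on each side.\<close>
      have "p ! m \<noteq> p ! 0" "p ! m \<noteq> p ! (length p - 1)"
        using b(2) p(3,4) m(2) by (auto simp: hd_conv_nth[OF \<open>p \<noteq> []\<close>] last_conv_nth[OF \<open>p \<noteq> []\<close>])
      then have "m \<noteq> 0" "m \<noteq> length p - 1" by auto
      then obtain i where i: "m = Suc i" "Suc m < length p"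
        using m(1) by (cases m) auto
      have pH: "set p \<subseteq> verts ?H"
        and arcs: "\<And>k. Suc k < length p \<Longrightarrow> (p ! k, p ! Suc k) \<in> arcs_ends ?H"
        using p(1)
        by (auto simp: induced_vpath_def vpath_def vwalk_def set_vwalk_arcs_subset_iff)
      \<comment> \<open>A vertex of \<open>?H\<close> never contains \<open>Suc n\<close>, so
        disjointness from \<open>A\<close> already gives disjointness from \<open>w\<close>.\<close>
      have w_adj: "(v, w) \<in> arcs_ends ?G" "(w, v) \<in> arcs_ends ?G"
        if "v \<in> verts ?H" "v \<inter> insert b A = {}" for v
      proof -
        have "Suc n \<notin> v" using that(1) by (auto simp: pverts_kneser_graph)
        then show "(v, w) \<in> arcs_ends ?G" "(w, v) \<in> arcs_ends ?G"
          using that w HG unfolding arcs_ends_kneser_graph w_eq by auto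
      qed
      have "(p ! i, w) \<in> arcs_ends ?G"
        using arcs[of i] m i by (intro w_adj) (auto simp only: arcs_ends_kneser_graph)
      moreover have "(w, p ! Suc m) \<in> arcs_ends ?G"
        using arcs[of m] m i by (intro w_adj) (auto simp only: arcs_ends_kneser_graph)
      moreover have "w \<notin> set p"
        using pH True by (fastforce simp: pverts_kneser_graph)
      ultimately have "w \<in> monophonic_interval ?G (hd p) (last p)"
        using i w by (intro G.mem_monophonic_interval_splice[OF p(2), where i = i and j = "Suc m"]) auto
      then show ?thesis using p(3,4) by blast
    next
      case inS: True
      \<comment> \<open>As \<open>2 * r \<le> n\<close>, the complement of \<open>A\<close> has at
        least \<open>r + 1\<close> elements, enough for \<open>b\<close>, \<open>c\<close> and the
        \<open>r - 1\<close> elements of \<open>X\<close>.\<close>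
      have cR: "card ({1..n} - A) = n - (r - 1)"
        using \<open>A \<subseteq> {1..n}\<close> \<open>finite A\<close> cA by (simp add: card_Diff_subset)
      then have "Suc r \<le> card ({1..n} - A)" using n r by auto
      then obtain T where T: "T \<subseteq> {1..n} - A" "card T = Suc r"
        by (meson obtain_subset_with_card_n)
      then obtain b T' where T': "T = insert b T'" "b \<notin> T'" "card T' = r"
        by (meson card_Suc_eq)
      have "r = Suc (r - 1)" using r by simp
      then obtain c X where X: "T' = insert c X" "c \<notin> X" "card X = r - 1"
        using T'(3) card_Suc_eq[of T' "r - 1"] by auto
      \<comment> \<open>Here \<open>2 \<le> r\<close> enters. Since \<open>card\<close> is 0 on
        infinite sets, a positive cardinality gives finiteness as well as nonemptiness.\<close>
      have "finite X" "X \<noteq> {}" "A \<noteq> {}"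
        using X(3) cA r card.infinite by fastforce+
      have mem: "b \<in> {1..n} - A" "c \<in> {1..n} - A" "b \<noteq> c" "b \<notin> X" "c \<notin> X" "X \<subseteq> {1..n} - A"
        using T T' X by auto
      define p where "p = [insert b A, insert c X, w, insert b X, insert c A]"
      have Xv: "insert d X \<in> verts ?H" if "d \<in> {1..n} - A" "d \<notin> X" for d
        using that r X(3) mem \<open>finite X\<close> by (auto simp: pverts_kneser_graph)
      have vs: "set p \<subseteq> verts ?G"
        using mem w HG vH Xv by (auto simp: p_def simp del: with_proj_simps)
      have nSuc: "Suc n \<notin> insert b (insert c X)" using mem by auto
      \<comment> \<open>Non-consecutive vertices meet: \<open>insert b A\<close>, \<open>w\<close>
        and \<open>insert c A\<close> share \<open>A\<close>, the two vertices built on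
        \<open>X\<close> share \<open>X\<close>, and the two remaining pairs share \<open>b\<close>
        or \<open>c\<close>.\<close>
      have tbl: "\<forall>j<5. \<forall>i<j. p ! i \<inter> p ! j = {} \<longleftrightarrow> j = Suc i"
      proof -
        have "A \<inter> X = {}" "X \<inter> A = {}" "b \<notin> A" "c \<notin> A" "Suc n \<notin> X" "b \<noteq> Suc n" "c \<noteq> Suc n"
          using mem nSuc by auto
        then show ?thesis
          using mem(3-5) \<open>Suc n \<notin> A\<close> \<open>A \<noteq> {}\<close> \<open>X \<noteq> {}\<close>
          by (simp add: All_less_Suc numeral_eq_Suc p_def w_eq Int_insert_left Int_insert_right)
      qed
      have "induced_vpath p ?G"
        unfolding G.induced_vpath_iff
      proof (intro conjI allI impI)
        show "p \<noteq> []" by (simp add: p_def)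
        show "set p \<subseteq> verts ?G" by (fact vs)
        \<comment> \<open>The element \<open>a\<close> separates the sets built on \<open>A\<close>
          from those built on \<open>X\<close>; within each kind, \<open>b\<close>, \<open>c\<close>
          and \<open>Suc n\<close> tell them apart.\<close>
        obtain a where "a \<in> A" using \<open>A \<noteq> {}\<close> by blast
        then show "distinct p"
          using mem nSuc \<open>Suc n \<notin> A\<close> by (auto simp: p_def w_eq)
        fix i j assume ij: "i < j \<and> j < length p"
        then have "(p ! i, p ! j) \<in> arcs_ends ?G \<longleftrightarrow> p ! i \<inter> p ! j = {}"
          using vs by (meson arcs_ends_kneser_graph less_trans nth_mem subsetD)
        also have "\<dots> \<longleftrightarrow> j = Suc i"
          using ij tbl by (simp add: p_def)
        finally show "(p ! i, p ! j) \<in> arcs_ends ?G \<longleftrightarrow> j = Suc i" .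
      qed
      then have "w \<in> monophonic_interval ?G (insert b A) (insert c A)"
        unfolding monophonic_interval_def by (auto simp: p_def intro!: exI[of _ p])
      then show ?thesis using inS mem by blast
    qed
  qed
  then show ?thesis
    using S HG unfolding monophonic_set_def by blast
qed

theorem theorem2p1:
  fixes n r :: nat
  assumes "0 < n" and "0 < r" and "2 * r \<le> n"
    and "r \<noteq> 1"
  shows "monophonic_number (kneser_graph n r) \<ge> monophonic_number (kneser_graph (n + 1) r) \<and>
    (\<forall>S. monophonic_set (kneser_graph n r) S \<longrightarrow> monophonic_set (kneser_graph (n + 1) r) S)"
proof
  interpret H: graph "with_proj (kneser_graph n r)"
    by (rule graph_kneser_graph) (use assms in simp)
  show mono: "\<forall>S. monophonic_set (kneser_graph n r) S \<longrightarrow> monophonic_set (kneser_graph (n + 1) r) S"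
    using monophonic_set_kneser_graph_Suc[of r n] assms by simp
  \<comment> \<open>A minimum monophonic set of the smaller graph is, by \<open>mono\<close>, a
    competitor of the same cardinality in the larger one.\<close>
  have "\<exists>S. monophonic_set (kneser_graph n r) S \<and> finite S \<and>
      card S = monophonic_number (kneser_graph n r)"
    unfolding monophonic_number_def
    by (rule LeastI_ex) (use H.monophonic_set_verts H.finite_verts in blast)
  with mono show "monophonic_number (kneser_graph (n + 1) r) \<le> monophonic_number (kneser_graph n r)"
    unfolding monophonic_number_def[of "with_proj (kneser_graph (n + 1) r)"]
    by (metis (mono_tags, lifting) Least_le)
qed

end
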